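(* For all real numbers $a,b>0$, $$(a-1)\log b+(b-1)\log a+2(a-1)(b-1)\;\ge\;-\left[(a-1)\log a+(b-1)\log b+\frac{(a-1)^2}{a}+\frac{(b-1)^2}{b}\right].$$
   Context: $\log$ is the natural logarithm. *)

theory Defs
  imports Complex_Main
begin

end

theory Submission
  imports Defs
begin

text \<open>
  With \<open>S = a + b\<close> and \<open>P = a * b\<close>, the difference of the two sides depends only on
  \<open>S\<close> and \<open>P\<close>, and it is affine in \<open>S\<close>:
  \<open>S * (ln P - (1 - 1 / P)) + 2 * (P - 1 - ln P)\<close>.
  Both brackets are nonnegative by the classical bounds \<open>1 - 1 / P \<le> ln P \<le> P - 1\<close>,
  and \<open>S > 0\<close>.
\<close>

theorem lemma2p6:
  fixes a b :: real
  assumes "a > 0" and "b > 0"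
  shows "(a - 1) * ln b + (b - 1) * ln a + 2 * (a - 1) * (b - 1)
    \<ge> - ((a - 1) * ln a + (b - 1) * ln b + (a - 1)\<^sup>2 / a + (b - 1)\<^sup>2 / b)"
proof -
  define P where "P = a * b"
  have P: "P > 0" using assms by (simp add: P_def)
  have ln_P: "ln P = ln a + ln b"
    using assms by (simp add: P_def ln_mult)
  have upper: "ln P \<le> P - 1"
    using P by (rule ln_le_minus_one)
  \<comment> \<open>The lower bound is the upper bound at the reciprocal.\<close>
  have lower: "ln P \<ge> 1 - 1 / P"
    using ln_le_minus_one[of "1 / P"] P by (simp add: ln_div)
  have square_div: "(x - 1)\<^sup>2 / x = x - 2 + 1 / x" if "x > 0" for x :: real
    using that by (simp add: field_simps power2_eq_square)
  have recip: "1 / a + 1 / b = (a + b) * (1 / P)"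
    using assms by (simp add: P_def field_simps)
  have "(a - 1) * ln b + (b - 1) * ln a + 2 * (a - 1) * (b - 1)
      + ((a - 1) * ln a + (b - 1) * ln b + (a - 1)\<^sup>2 / a + (b - 1)\<^sup>2 / b)
      = (a + b - 2) * ln P + 2 * P - (a + b) - 2 + (1 / a + 1 / b)"
    unfolding square_div[OF assms(1)] square_div[OF assms(2)] ln_P
    by (simp add: P_def algebra_simps)
  also have "\<dots> = (a + b) * (ln P - (1 - 1 / P)) + 2 * (P - 1 - ln P)"
    unfolding recip by (simp add: algebra_simps)
  also have "\<dots> \<ge> 0"
    using assms lower upper by simp
  finally show ?thesis by simp
qed

end
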